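(* Let $\mathcal V$ be a commutative quantale. The $\mathcal V\text{-}\mathsf{cat}$-functor $D:\mathsf{Set}\to\mathcal V\text{-}\mathsf{cat}$ sending each set to the discrete $\mathcal V$-category on it is fully faithful (in the $\mathcal V\text{-}\mathsf{cat}$-enriched sense: every $\mathcal V$-functor $D_{X,Y}:\mathsf{Set}(X,Y)\to\mathcal V\text{-}\mathsf{cat}(DX,DY)$ is an isomorphism of $\mathcal V$-categories) if and only if the quantale $\mathcal V$ is integral.
   Context: $\mathcal V=(\mathcal V_o,\otimes,e,[-,-])$ is a commutative quantale: a complete lattice with a commutative, associative, monotone operation $\otimes$ with unit $e$, such that each $-\otimes r$ has a right adjoint $[r,-]$; $\mathcal V$ is assumed non-trivial ($e\neq\bot$). It is integral if $e=\top$. A (small) $\mathcal V$-category $\mathcal X$ is a set of objects together with elements $\mathcal X(x',x)\in\mathcal V_o$ satisfying $e\le\mathcal X(x,x)$ and $\mathcal X(x',x)\otimes\mathcal X(x'',x')\le\mathcal X(x'',x)$; a $\mathcal V$-functor $f:\mathcal X\to\mathcal Y$ is a map on objects with $\mathcal X(x',x)\le\mathcal Y(fx',fx)$. $\mathcal V\text{-}\mathsf{cat}$ is the symmetric monoidal closed category of small $\mathcal V$-categories and $\mathcal V$-functors, with $(\mathcal X\otimes\mathcal Y)((x',y'),(x,y))=\mathcal X(x',x)\otimes\mathcal Y(y',y)$, unit $\mathbb 1$ (one object $0$ with $\mathbb 1(0,0)=e$), and internal hom $[\mathcal Y,\mathcal Z]=\mathcal V\text{-}\mathsf{cat}(\mathcal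 Y,\mathcal Z)$ whose objects are $\mathcal V$-functors, with $[\mathcal Y,\mathcal Z](f,g)=\bigwedge_y\mathcal Z(fy,gy)$ (so the empty meet is $\top$); it is enriched over itself. A $\mathcal V$-category is discrete if $\mathcal X(x',x)=e$ for $x'=x$ and $\bot$ otherwise. $\mathsf{Set}$ is regarded as a $\mathcal V\text{-}\mathsf{cat}$-category in which $\mathsf{Set}(X,Y)$ is the discrete $\mathcal V$-category on the set of functions $X\to Y$. $DX$ is the discrete $\mathcal V$-category with object set $X$, and $D_{X,Y}$ sends $f$ to the $\mathcal V$-functor $Df$ with the same action on objects. *)

theory Defs
  imports Main "HOL-Library.FuncSet"
begin

section \<open>Commutative quantales\<close>

text \<open>The tensor product is written \<open>*\<close>, its unit \<open>1\<close>, and \<open>residual r\<close> is the right adjoint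
  \<open>[r, -]\<close> of \<open>- * r\<close>. Monotonicity of \<open>*\<close> follows from the adjunction (\<open>quantale_mult_mono\<close>).\<close>

class comm_quantale = complete_lattice + comm_monoid_mult +
  fixes residual :: "'a \<Rightarrow> 'a \<Rightarrow> 'a"
  assumes residual_adjoint: "x * r \<le> y \<longleftrightarrow> x \<le> residual r y"

class nontrivial_comm_quantale = comm_quantale +
  assumes one_neq_bot: "1 \<noteq> bot"

lemma quantale_mult_mono:
  fixes a b c d :: "'v::comm_quantale"
  assumes "a \<le> b" "c \<le> d"
  shows "a * c \<le> b * d"
proof -
  have mono: "x * r \<le> y * r" if "x \<le> y" for x y r :: 'v
    using that residual_adjoint order_refl order_trans by metis
  have "a * c \<le> b * c" using assms(1) by (rule mono)
  also have "b * c \<le> b * d" using mono[OF assms(2), of b] by (simp add: mult.commute)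
  finally show ?thesis .
qed

lemma quantale_bot_mult [simp]:
  fixes x :: "'v::comm_quantale"
  shows "bot * x = bot" "x * bot = bot"
proof -
  show "bot * x = bot" using residual_adjoint[of bot x bot] by (simp add: bot_unique)
  then show "x * bot = bot" by (simp add: mult.commute)
qed

definition integral_quantale :: "'v::comm_quantale itself \<Rightarrow> bool" where
  "integral_quantale _ \<longleftrightarrow> (1 :: 'v) = top"


section \<open>Categories enriched in a quantale\<close>

record ('o, 'v) vcat =
  Ob :: "'o set"
  Hom :: "'o \<Rightarrow> 'o \<Rightarrow> 'v"

text \<open>The last clause is only a normalisation of the values of \<open>Hom\<close> outside \<open>Ob\<close>; it makes
  equality of records coincide with equality of \<open>\<V>\<close>-categories.\<close>

definition vcategory :: "('o, 'v::comm_quantale) vcat \<Rightarrow> bool" where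
  "vcategory X \<longleftrightarrow>
    (\<forall>x\<in>Ob X. 1 \<le> Hom X x x) \<and>
    (\<forall>x\<in>Ob X. \<forall>x'\<in>Ob X. \<forall>x''\<in>Ob X. Hom X x' x * Hom X x'' x' \<le> Hom X x'' x) \<and>
    (\<forall>x' x. x' \<notin> Ob X \<or> x \<notin> Ob X \<longrightarrow> Hom X x' x = bot)"

text \<open>Maps between carriers are extensional functions, so that equality in HOL is equality of
  maps on the carrier.\<close>

definition vfunctor ::
    "('a, 'v::comm_quantale) vcat \<Rightarrow> ('b, 'v) vcat \<Rightarrow> ('a \<Rightarrow> 'b) \<Rightarrow> bool" where
  "vfunctor X Y f \<longleftrightarrow>
    f \<in> Ob X \<rightarrow>\<^sub>E Ob Y \<and>
    (\<forall>x'\<in>Ob X. \<forall>x\<in>Ob X. Hom X x' x \<le> Hom Y (f x') (f x))"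

definition viso ::
    "('a, 'v::comm_quantale) vcat \<Rightarrow> ('b, 'v) vcat \<Rightarrow> ('a \<Rightarrow> 'b) \<Rightarrow> bool" where
  "viso X Y f \<longleftrightarrow>
    vfunctor X Y f \<and>
    (\<exists>g. vfunctor Y X g \<and>
         compose (Ob X) g f = (\<lambda>x\<in>Ob X. x) \<and>
         compose (Ob Y) f g = (\<lambda>y\<in>Ob Y. y))"

definition vtensor ::
    "('a, 'v::comm_quantale) vcat \<Rightarrow> ('b, 'v) vcat \<Rightarrow> ('a \<times> 'b, 'v) vcat" where
  "vtensor X Y =
    \<lparr>Ob = Ob X \<times> Ob Y,
     Hom = (\<lambda>(x', y') (x, y). Hom X x' x * Hom Y y' y)\<rparr>"

definition vunit :: "(unit, 'v::comm_quantale) vcat" where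
  "vunit = \<lparr>Ob = {()}, Hom = (\<lambda>_ _. 1)\<rparr>"

definition vhom ::
    "('a, 'v::comm_quantale) vcat \<Rightarrow> ('b, 'v) vcat \<Rightarrow> ('a \<Rightarrow> 'b, 'v) vcat" where
  "vhom Y Z =
    \<lparr>Ob = {f. vfunctor Y Z f},
     Hom = (\<lambda>f g. if vfunctor Y Z f \<and> vfunctor Y Z g
                  then (INF y\<in>Ob Y. Hom Z (f y) (g y)) else bot)\<rparr>"

definition discrete :: "'a set \<Rightarrow> ('a, 'v::comm_quantale) vcat" where
  "discrete X = \<lparr>Ob = X, Hom = (\<lambda>x' x. if x' = x \<and> x \<in> X then 1 else bot)\<rparr>"


section \<open>Categories enriched in \<open>\<V>\<close>-cat\<close>

text \<open>\<open>VComp C X Y Z\<close> is the composition \<open>C(Y, Z) \<otimes> C(X, Y) \<rightarrow> C(X, Z)\<close> and \<open>VId C X\<close> the unit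
  \<open>\<one> \<rightarrow> C(X, X)\<close>.\<close>

record ('o, 'm, 'v) vcat_cat =
  Obj :: "'o set"
  Mor :: "'o \<Rightarrow> 'o \<Rightarrow> ('m, 'v) vcat"
  VComp :: "'o \<Rightarrow> 'o \<Rightarrow> 'o \<Rightarrow> 'm \<times> 'm \<Rightarrow> 'm"
  VId :: "'o \<Rightarrow> unit \<Rightarrow> 'm"

text \<open>A diagram of \<open>\<V>\<close>-functors commutes iff it commutes on objects, so the associativity and
  unit axioms are stated elementwise.\<close>

locale vcat_category =
  fixes C :: "('o, 'm, 'v::comm_quantale) vcat_cat"
  assumes vcategory_Mor:
      "\<lbrakk>X \<in> Obj C; Y \<in> Obj C\<rbrakk> \<Longrightarrow> vcategory (Mor C X Y)"
    and vfunctor_VComp: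
      "\<lbrakk>X \<in> Obj C; Y \<in> Obj C; Z \<in> Obj C\<rbrakk>
       \<Longrightarrow> vfunctor (vtensor (Mor C Y Z) (Mor C X Y)) (Mor C X Z) (VComp C X Y Z)"
    and vfunctor_VId:
      "X \<in> Obj C \<Longrightarrow> vfunctor vunit (Mor C X X) (VId C X)"
    and VComp_assoc:
      "\<lbrakk>W \<in> Obj C; X \<in> Obj C; Y \<in> Obj C; Z \<in> Obj C;
        h \<in> Ob (Mor C Y Z); g \<in> Ob (Mor C X Y); f \<in> Ob (Mor C W X)\<rbrakk>
       \<Longrightarrow> VComp C W X Z (VComp C X Y Z (h, g), f) = VComp C W Y Z (h, VComp C W X Y (g, f))"
    and VComp_VId_left:
      "\<lbrakk>X \<in> Obj C; Y \<in> Obj C; f \<in> Ob (Mor C X Y)\<rbrakk> \<Longrightarrow> VComp C X Y Y (VId C Y (), f) = f"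
    and VComp_VId_right:
      "\<lbrakk>X \<in> Obj C; Y \<in> Obj C; f \<in> Ob (Mor C X Y)\<rbrakk> \<Longrightarrow> VComp C X X Y (f, VId C X ()) = f"

locale vcat_functor =
  source: vcat_category C + target: vcat_category D
  for C :: "('o, 'm, 'v::comm_quantale) vcat_cat"
    and D :: "('p, 'n, 'v) vcat_cat" +
  fixes Fo :: "'o \<Rightarrow> 'p"
    and Fm :: "'o \<Rightarrow> 'o \<Rightarrow> 'm \<Rightarrow> 'n"
  assumes Fo_Obj:
      "X \<in> Obj C \<Longrightarrow> Fo X \<in> Obj D"
    and vfunctor_Fm:
      "\<lbrakk>X \<in> Obj C; Y \<in> Obj C\<rbrakk> \<Longrightarrow> vfunctor (Mor C X Y) (Mor D (Fo X) (Fo Y)) (Fm X Y)"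
    and Fm_VComp:
      "\<lbrakk>X \<in> Obj C; Y \<in> Obj C; Z \<in> Obj C; g \<in> Ob (Mor C Y Z); f \<in> Ob (Mor C X Y)\<rbrakk>
       \<Longrightarrow> Fm X Z (VComp C X Y Z (g, f)) = VComp D (Fo X) (Fo Y) (Fo Z) (Fm Y Z g, Fm X Y f)"
    and Fm_VId:
      "X \<in> Obj C \<Longrightarrow> Fm X X (VId C X ()) = VId D (Fo X) ()"

locale fully_faithful_vcat_functor = vcat_functor +
  assumes viso_Fm:
    "\<lbrakk>X \<in> Obj C; Y \<in> Obj C\<rbrakk> \<Longrightarrow> viso (Mor C X Y) (Mor D (Fo X) (Fo Y)) (Fm X Y)"


section \<open>The functor from sets to discrete \<open>\<V>\<close>-categories\<close>

text \<open>The type \<open>'u\<close> plays the role of the universe: small sets are the subsets of \<open>'u\<close>, and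
  small \<open>\<V>\<close>-categories are those whose objects form a subset of \<open>'u\<close>.\<close>

definition SET :: "('u set, 'u \<Rightarrow> 'u, 'v::comm_quantale) vcat_cat" where
  "SET =
    \<lparr>Obj = UNIV,
     Mor = (\<lambda>X Y. discrete (X \<rightarrow>\<^sub>E Y)),
     VComp = (\<lambda>X Y Z. \<lambda>(g, f) \<in> (Y \<rightarrow>\<^sub>E Z) \<times> (X \<rightarrow>\<^sub>E Y). compose X g f),
     VId = (\<lambda>X _. \<lambda>x\<in>X. x)\<rparr>"

definition VCAT :: "(('u, 'v::comm_quantale) vcat, 'u \<Rightarrow> 'u, 'v) vcat_cat" where
  "VCAT =
    \<lparr>Obj = {X. vcategory X},
     Mor = vhom,
     VComp = (\<lambda>X Y Z. \<lambda>(g, f) \<in> Ob (vhom Y Z) \<times> Ob (vhom X Y). compose (Ob X) g f),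
     VId = (\<lambda>X _. \<lambda>x\<in>Ob X. x)\<rparr>"

definition discrete_mor :: "'u set \<Rightarrow> 'u set \<Rightarrow> ('u \<Rightarrow> 'u) \<Rightarrow> ('u \<Rightarrow> 'u)" where
  "discrete_mor X Y = (\<lambda>f \<in> X \<rightarrow>\<^sub>E Y. f)"

lemma vfunctorI:
  assumes "f \<in> Ob X \<rightarrow>\<^sub>E Ob Y"
    and "\<And>x' x. \<lbrakk>x' \<in> Ob X; x \<in> Ob X\<rbrakk> \<Longrightarrow> Hom X x' x \<le> Hom Y (f x') (f x)"
  shows "vfunctor X Y f"
  using assms by (simp add: vfunctor_def)

lemma Ob_discrete: "Ob (discrete X) = X"
  and Hom_discrete: "Hom (discrete X) x' x = (if x' = x \<and> x \<in> X then 1 else bot)"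
  by (simp_all add: discrete_def)

lemma vcategory_discrete: "vcategory (discrete X :: ('a, 'v::comm_quantale) vcat)"
  by (auto simp: vcategory_def discrete_def)

lemma vfunctor_discrete:
  "vfunctor (discrete X :: ('a, 'v::comm_quantale) vcat) (discrete Y) f \<longleftrightarrow> f \<in> X \<rightarrow>\<^sub>E Y"
  by (auto simp: vfunctor_def discrete_def PiE_iff)

lemma vfunctor_compose:
  assumes "vfunctor X Y f" "vfunctor Y Z g"
  shows "vfunctor X Z (compose (Ob X) g f)"
proof -
  have "compose (Ob X) g f \<in> Ob X \<rightarrow>\<^sub>E Ob Z"
    using assms by (auto simp: vfunctor_def compose_def PiE_iff)
  moreover have "Hom X x' x \<le> Hom Z (g (f x')) (g (f x))" if "x' \<in> Ob X" "x \<in> Ob X" for x' x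
  proof -
    have "Hom X x' x \<le> Hom Y (f x') (f x)" using assms that by (auto simp: vfunctor_def)
    also have "\<dots> \<le> Hom Z (g (f x')) (g (f x))"
      using assms that by (auto simp: vfunctor_def PiE_iff)
    finally show ?thesis .
  qed
  ultimately show ?thesis by (auto simp: vfunctor_def compose_def)
qed

lemma vfunctor_id: "vfunctor X X (\<lambda>x\<in>Ob X. x)"
  by (auto simp: vfunctor_def)

lemma vcategory_vhom:
  fixes Y :: "('a, 'v::comm_quantale) vcat" and Z :: "('b, 'v) vcat"
  assumes "vcategory Z"
  shows "vcategory (vhom Y Z)"
proof -
  have id: "1 \<le> (INF y\<in>Ob Y. Hom Z (f y) (f y))" if "vfunctor Y Z f" for f
    using assms that by (auto intro!: INF_greatest simp: vcategory_def vfunctor_def PiE_iff)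
  have comp: "(INF y\<in>Ob Y. Hom Z (g y) (h y)) * (INF y\<in>Ob Y. Hom Z (f y) (g y))
      \<le> (INF y\<in>Ob Y. Hom Z (f y) (h y))"
    if "vfunctor Y Z f" "vfunctor Y Z g" "vfunctor Y Z h" for f g h
  proof (rule INF_greatest)
    fix y assume y: "y \<in> Ob Y"
    have "(INF y\<in>Ob Y. Hom Z (g y) (h y)) * (INF y\<in>Ob Y. Hom Z (f y) (g y))
        \<le> Hom Z (g y) (h y) * Hom Z (f y) (g y)"
      using y by (intro quantale_mult_mono INF_lower)
    also have "\<dots> \<le> Hom Z (f y) (h y)"
      using assms that y by (auto simp: vcategory_def vfunctor_def PiE_iff)
    finally show "(INF y\<in>Ob Y. Hom Z (g y) (h y)) * (INF y\<in>Ob Y. Hom Z (f y) (g y))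
        \<le> Hom Z (f y) (h y)" .
  qed
  show ?thesis using id comp by (auto simp: vcategory_def vhom_def)
qed

lemma vfunctor_vhom_comp:
  fixes X :: "('a, 'v::comm_quantale) vcat" and Y :: "('b, 'v) vcat" and Z :: "('c, 'v) vcat"
  assumes "vcategory Z"
  shows "vfunctor (vtensor (vhom Y Z) (vhom X Y)) (vhom X Z)
    (\<lambda>(g, f) \<in> Ob (vhom Y Z) \<times> Ob (vhom X Y). compose (Ob X) g f)"
proof -
  have "(INF y\<in>Ob Y. Hom Z (g' y) (g y)) * (INF x\<in>Ob X. Hom Y (f' x) (f x))
      \<le> (INF x\<in>Ob X. Hom Z (compose (Ob X) g' f' x) (compose (Ob X) g f x))"
    if "vfunctor Y Z g'" "vfunctor Y Z g" "vfunctor X Y f'" "vfunctor X Y f" for g' g f' f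
  proof (rule INF_greatest)
    fix x assume x: "x \<in> Ob X"
    have fx: "f x \<in> Ob Y" "f' x \<in> Ob Y" using that x by (auto simp: vfunctor_def PiE_iff)
    have "(INF y\<in>Ob Y. Hom Z (g' y) (g y)) * (INF x\<in>Ob X. Hom Y (f' x) (f x))
        \<le> Hom Z (g' (f x)) (g (f x)) * Hom Y (f' x) (f x)"
      using x fx by (intro quantale_mult_mono INF_lower)
    also have "\<dots> \<le> Hom Z (g' (f x)) (g (f x)) * Hom Z (g' (f' x)) (g' (f x))"
      using that fx by (intro quantale_mult_mono) (auto simp: vfunctor_def)
    also have "\<dots> \<le> Hom Z (g' (f' x)) (g (f x))"
      using assms that fx by (auto simp: vcategory_def vfunctor_def PiE_iff)
    finally show "(INF y\<in>Ob Y. Hom Z (g' y) (g y)) * (INF x\<in>Ob X. Hom Y (f' x) (f x))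
        \<le> Hom Z (compose (Ob X) g' f' x) (compose (Ob X) g f x)"
      using x by (simp add: compose_eq)
  qed
  then show ?thesis
    by (intro vfunctorI) (auto simp: vtensor_def vhom_def vfunctor_compose)
qed

lemma vcat_category_SET: "vcat_category (SET :: ('u set, 'u \<Rightarrow> 'u, 'v::comm_quantale) vcat_cat)"
proof
  fix X Y Z :: "'u set"
  show "vfunctor (vtensor (Mor SET Y Z) (Mor SET X Y)) (Mor SET X Z)
      (VComp (SET :: ('u set, 'u \<Rightarrow> 'u, 'v) vcat_cat) X Y Z)"
    by (auto simp: SET_def vfunctor_def vtensor_def discrete_def compose_def PiE_iff)
qed (auto simp: SET_def vcategory_discrete vfunctor_def vunit_def Ob_discrete Hom_discrete compose_def
    PiE_iff extensional_def fun_eq_iff)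

lemma vcat_category_VCAT: "vcat_category (VCAT :: (('u, 'v::comm_quantale) vcat, _, _) vcat_cat)"
proof
  fix X :: "('u, 'v) vcat"
  assume "X \<in> Obj VCAT"
  then have "1 \<le> Hom (vhom X X) (\<lambda>x\<in>Ob X. x) (\<lambda>x\<in>Ob X. x)"
    using vcategory_vhom[of X X] vfunctor_id[of X] by (auto simp: VCAT_def vcategory_def vhom_def)
  then show "vfunctor vunit (Mor VCAT X X) (VId VCAT X)"
    using vfunctor_id[of X] by (intro vfunctorI) (auto simp: VCAT_def vunit_def vhom_def)
next
  fix W X Y Z :: "('u, 'v) vcat" and h g f
  assume *: "h \<in> Ob (Mor VCAT Y Z)" "g \<in> Ob (Mor VCAT X Y)" "f \<in> Ob (Mor VCAT W X)"
  then have "f \<in> Ob W \<rightarrow> Ob X" by (auto simp: VCAT_def vhom_def vfunctor_def)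
  then show "VComp VCAT W X Z (VComp VCAT X Y Z (h, g), f)
      = VComp VCAT W Y Z (h, VComp VCAT W X Y (g, f))"
    using * by (simp add: VCAT_def vhom_def vfunctor_compose compose_assoc)
next
  fix X Y :: "('u, 'v) vcat" and f
  assume "f \<in> Ob (Mor VCAT X Y)"
  then have f: "vfunctor X Y f" "f \<in> Ob X \<rightarrow> Ob Y" "f \<in> extensional (Ob X)"
    by (auto simp: VCAT_def vhom_def vfunctor_def PiE_def)
  then show "VComp VCAT X Y Y (VId VCAT Y (), f) = f" "VComp VCAT X X Y (f, VId VCAT X ()) = f"
    by (simp_all add: VCAT_def vhom_def vfunctor_id Id_compose compose_Id)
qed (auto simp: VCAT_def vcategory_vhom vfunctor_vhom_comp)

lemma vcat_functor_discrete:
  "vcat_functor (SET :: ('u set, 'u \<Rightarrow> 'u, 'v::comm_quantale) vcat_cat) VCAT discrete discrete_mor"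
proof (intro vcat_functor.intro vcat_category_SET vcat_category_VCAT vcat_functor_axioms.intro)
  fix X Y :: "'u set"
  have "1 \<le> (INF x\<in>X. Hom (discrete Y :: ('u, 'v) vcat) (f x) (f x))" if "f \<in> X \<rightarrow>\<^sub>E Y" for f
    using that by (auto intro!: INF_greatest simp: discrete_def PiE_iff)
  then show "vfunctor (Mor (SET :: ('u set, 'u \<Rightarrow> 'u, 'v) vcat_cat) X Y)
      (Mor VCAT (discrete X) (discrete Y)) (discrete_mor X Y)"
    by (intro vfunctorI)
       (auto simp: SET_def VCAT_def vhom_def vfunctor_discrete discrete_mor_def
          Ob_discrete Hom_discrete[of "_ \<rightarrow>\<^sub>E _"])
next
  fix X Y Z :: "'u set" and g f
  assume *: "g \<in> Ob (Mor (SET :: ('u set, 'u \<Rightarrow> 'u, 'v) vcat_cat) Y Z)"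
    "f \<in> Ob (Mor (SET :: ('u set, 'u \<Rightarrow> 'u, 'v) vcat_cat) X Y)"
  then have gf: "g \<in> Y \<rightarrow>\<^sub>E Z" "f \<in> X \<rightarrow>\<^sub>E Y" by (auto simp: SET_def discrete_def)
  then have "compose X g f \<in> X \<rightarrow>\<^sub>E Z" by (auto simp: compose_def PiE_iff)
  with gf show "discrete_mor X Z (VComp (SET :: ('u set, 'u \<Rightarrow> 'u, 'v) vcat_cat) X Y Z (g, f))
      = VComp (VCAT :: (('u, 'v) vcat, _, _) vcat_cat) (discrete X) (discrete Y) (discrete Z)
          (discrete_mor Y Z g, discrete_mor X Y f)"
    by (simp add: SET_def VCAT_def vhom_def vfunctor_discrete discrete_mor_def)
       (simp add: discrete_def)
qed (auto simp: SET_def VCAT_def vcategory_discrete discrete_mor_def Ob_discrete)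

end

(* The only hom objects at which the discrete functor can fail to be fully faithful are those out of
   the empty set: there the empty meet gives hom-value top, against the value 1 in Set({}, Y).
   For nonempty X the meet is 1 on the diagonal and bot off it, whatever the quantale is. *)
theory Submission imports Defs begin

text \<open>The functor \<open>f\<close> gives one inequality; the other comes from applying its
  inverse \<open>g\<close> to \<open>f x'\<close> and \<open>f x\<close>.\<close>

lemma viso_Hom_eq:
  assumes "viso X Y f" "x' \<in> Ob X" "x \<in> Ob X"
  shows "Hom Y (f x') (f x) = Hom X x' x"
proof (rule antisym)
  obtain g where f: "vfunctor X Y f" and g: "vfunctor Y X g"
    and gf: "compose (Ob X) g f = (\<lambda>x\<in>Ob X. x)"
    using assms(1) by (auto simp: viso_def)
  have inv: "g (f z) = z" if "z \<in> Ob X" for z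
    using fun_cong[OF gf, of z] that by (simp add: compose_eq)
  show "Hom X x' x \<le> Hom Y (f x') (f x)"
    using f assms by (simp add: vfunctor_def)
  have "f x' \<in> Ob Y" "f x \<in> Ob Y"
    using f assms by (auto simp: vfunctor_def)
  then have "Hom Y (f x') (f x) \<le> Hom X (g (f x')) (g (f x))"
    using g by (simp add: vfunctor_def)
  then show "Hom Y (f x') (f x) \<le> Hom X x' x"
    using assms by (simp add: inv)
qed

text \<open>\<open>discrete_mor X Y\<close> is this restricted identity on
  \<open>X \<rightarrow>\<^sub>E Y\<close>, so it is an isomorphism once the two hom objects are
  equal.\<close>

lemma viso_id: "viso X X (\<lambda>x\<in>Ob X. x)"
  unfolding viso_def using vfunctor_id[of X]
  by (auto simp: compose_def intro!: exI[of _ "\<lambda>x\<in>Ob X. x"])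

text \<open>Every function between discrete categories is a functor, so only the hom-values need
  comparing.\<close>

lemma vhom_discrete:
  fixes X :: "'a set" and Y :: "'b set"
  assumes "integral_quantale TYPE('v::comm_quantale)"
  shows "vhom (discrete X :: ('a, 'v) vcat) (discrete Y) = discrete (X \<rightarrow>\<^sub>E Y)"
proof -
  have INF: "(INF x\<in>X. if f x = g x \<and> g x \<in> Y then 1 else bot :: 'v) = (if f = g then 1 else bot)"
    if f: "f \<in> X \<rightarrow>\<^sub>E Y" and g: "g \<in> X \<rightarrow>\<^sub>E Y" for f g
  proof (cases "f = g")
    case True
    \<comment> \<open>Replacing 1 by \<open>top\<close> covers empty \<open>X\<close> as well: a
      meet of tops is \<open>top\<close> over any index set.\<close>
    then have "(INF x\<in>X. if f x = g x \<and> g x \<in> Y then 1 else bot :: 'v) = (INF x\<in>X. top)"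
      using g assms by (intro INF_cong) (auto simp: integral_quantale_def)
    also have "\<dots> = 1"
      by (simp add: integral_quantale_def[THEN iffD1, OF assms])
    finally show ?thesis
      using True by simp
  next
    case False
    \<comment> \<open>Distinct extensional functions differ at a point of \<open>X\<close>, and
      \<open>bot\<close> there pulls down the whole meet.\<close>
    then obtain x where x: "x \<in> X" "f x \<noteq> g x"
      using PiE_ext[OF f g] by blast
    have "(INF x\<in>X. if f x = g x \<and> g x \<in> Y then 1 else bot :: 'v) \<le> bot"
      by (rule INF_lower2[OF x(1)]) (use x in simp)
    with False show ?thesis
      by (simp add: bot_unique)
  qed
  \<comment> \<open>Outside the function set both sides default to \<open>bot\<close>, so the
    records are equal.\<close>
  have "(if f \<in> X \<rightarrow>\<^sub>E Y \<and> g \<in> X \<rightarrow>\<^sub>E Y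
         then INF x\<in>X. if f x = g x \<and> g x \<in> Y then 1 else bot else bot :: 'v)
      = (if f = g \<and> g \<in> X \<rightarrow>\<^sub>E Y then 1 else bot)" for f g
    using INF[of f g] by (cases "f \<in> X \<rightarrow>\<^sub>E Y \<and> g \<in> X \<rightarrow>\<^sub>E Y") auto
  then show ?thesis
    unfolding vhom_def vfunctor_discrete Ob_discrete Hom_discrete
    by (simp only: discrete_def Collect_mem_eq)
qed

theorem proposition2p13:
  shows "fully_faithful_vcat_functor
           (SET :: ('u set, 'u \<Rightarrow> 'u, 'v::nontrivial_comm_quantale) vcat_cat)
           (VCAT :: (('u, 'v) vcat, 'u \<Rightarrow> 'u, 'v) vcat_cat)
           discrete discrete_mor
         \<longleftrightarrow> integral_quantale TYPE('v)"
    (is "?ff \<longleftrightarrow> ?int")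
proof
  assume ?ff
  then interpret fully_faithful_vcat_functor
    "SET :: ('u set, 'u \<Rightarrow> 'u, 'v) vcat_cat" VCAT discrete discrete_mor .
  \<comment> \<open>\<open>?u\<close> encodes the empty map, the only element of
    \<open>?E \<rightarrow>\<^sub>E ?E\<close>.\<close>
  let ?E = "{} :: 'u set" and ?u = "\<lambda>_. undefined :: 'u"
  have "viso (discrete (?E \<rightarrow>\<^sub>E ?E) :: (_, 'v) vcat) (vhom (discrete ?E) (discrete ?E))
      (discrete_mor ?E ?E)"
    using viso_Fm[of ?E ?E] by (simp add: SET_def VCAT_def)
  \<comment> \<open>The hom-value at \<open>?u\<close> is 1 in the source and the empty meet
    \<open>top\<close> in the target.\<close>
  from viso_Hom_eq[OF this, of ?u ?u] show ?int
    by (simp add: integral_quantale_def Ob_discrete Hom_discrete discrete_mor_def vhom_def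
        vfunctor_discrete)
next
  assume int: ?int
  show ?ff
  proof (intro fully_faithful_vcat_functor.intro vcat_functor_discrete
      fully_faithful_vcat_functor_axioms.intro)
    fix X Y :: "'u set"
    show "viso (Mor (SET :: ('u set, 'u \<Rightarrow> 'u, 'v) vcat_cat) X Y)
        (Mor VCAT (discrete X) (discrete Y)) (discrete_mor X Y)"
      using viso_id[of "discrete (X \<rightarrow>\<^sub>E Y) :: (_, 'v) vcat"]
      by (simp add: SET_def VCAT_def vhom_discrete[OF int] discrete_mor_def Ob_discrete)
  qed
qed

end
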